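(* Let $m\geq 3$ and $G=\mathrm{Sp}(1)^m/\langle(-1,\dots,-1)\rangle$. Let $\Gamma=(\mathbb{Z}/4\mathbb{Z})^2$ with two generators $\gamma_1,\gamma_2$. Define homomorphisms $\phi,\phi':\Gamma\to\mathrm{Sp}(1)^m$ by $$\phi(\gamma_1)=\phi'(\gamma_1)=(1,\dots,1,\mathbf{i},\mathbf{i}),\quad \phi(\gamma_2)=(\mathbf{i},\dots,\mathbf{i},1,\mathbf{i}),\quad \phi'(\gamma_2)=(\mathbf{i},\dots,\mathbf{i},1,-\mathbf{i}),$$ where in each tuple the first $m-2$ entries are equal. Let $\pi:\mathrm{Sp}(1)^m\to G$ be the natural projection, and set $\rho=\pi\circ\phi$, $\rho'=\pi\circ\phi'$. Then $\rho$ and $\rho'$ are element-conjugate but not globally conjugate. Thus $G$ is unacceptable.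
   Context: $\mathrm{Sp}(1)$ is the group of unit quaternions, with $\mathbf{i},\mathbf{j},\mathbf{k}$ the standard quaternion units. Let $G$ be a Lie group and $\Gamma$ a group. Two homomorphisms $\phi_1,\phi_2:\Gamma\to G$ are element-conjugate if for every $x\in\Gamma$ the elements $\phi_1(x)$ and $\phi_2(x)$ are conjugate in $G$. They are globally conjugate if there exists $g\in G$ with $\phi_2(x)=g\phi_1(x)g^{-1}$ for all $x\in\Gamma$. $G$ is acceptable if, for every finite group $\Gamma$, any two element-conjugate homomorphisms $\Gamma\to G$ are globally conjugate; otherwise $G$ is unacceptable. *)

theory Defs
  imports Complex_Main "HOL-Algebra.Algebra"
begin

datatype quaternion = Quat (qre: real) (qi: real) (qj: real) (qk: real)

instantiation quaternion :: ring_1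
begin

definition zero_quaternion :: quaternion where "0 = Quat 0 0 0 0"

definition one_quaternion :: quaternion where "1 = Quat 1 0 0 0"

definition plus_quaternion :: "quaternion \<Rightarrow> quaternion \<Rightarrow> quaternion" where
  "x + y = Quat (qre x + qre y) (qi x + qi y) (qj x + qj y) (qk x + qk y)"

definition uminus_quaternion :: "quaternion \<Rightarrow> quaternion" where
  "- x = Quat (- qre x) (- qi x) (- qj x) (- qk x)"

definition minus_quaternion :: "quaternion \<Rightarrow> quaternion \<Rightarrow> quaternion" where
  "x - y = Quat (qre x - qre y) (qi x - qi y) (qj x - qj y) (qk x - qk y)"

definition times_quaternion :: "quaternion \<Rightarrow> quaternion \<Rightarrow> quaternion" where
  "x * y = Quat
     (qre x * qre y - qi x * qi y - qj x * qj y - qk x * qk y)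
     (qre x * qi y + qi x * qre y + qj x * qk y - qk x * qj y)
     (qre x * qj y - qi x * qk y + qj x * qre y + qk x * qi y)
     (qre x * qk y + qi x * qj y - qj x * qi y + qk x * qre y)"

instance
  by standard
    (simp_all add: zero_quaternion_def one_quaternion_def plus_quaternion_def
      uminus_quaternion_def minus_quaternion_def times_quaternion_def algebra_simps)

end

definition quat_ii :: quaternion ("\<i>\<^sub>\<bbbH>") where "\<i>\<^sub>\<bbbH> = Quat 0 1 0 0"

definition quat_jj :: quaternion ("\<j>\<^sub>\<bbbH>") where "\<j>\<^sub>\<bbbH> = Quat 0 0 1 0"

definition quat_kk :: quaternion ("\<k>\<^sub>\<bbbH>") where "\<k>\<^sub>\<bbbH> = Quat 0 0 0 1"

lemma quaternion_units:
  "\<i>\<^sub>\<bbbH> * \<i>\<^sub>\<bbbH> = - 1" "\<j>\<^sub>\<bbbH> * \<j>\<^sub>\<bbbH> = - 1" "\<k>\<^sub>\<bbbH> * \<k>\<^sub>\<bbbH> = - 1"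
  "\<i>\<^sub>\<bbbH> * \<j>\<^sub>\<bbbH> = \<k>\<^sub>\<bbbH>" "\<j>\<^sub>\<bbbH> * \<k>\<^sub>\<bbbH> = \<i>\<^sub>\<bbbH>" "\<k>\<^sub>\<bbbH> * \<i>\<^sub>\<bbbH> = \<j>\<^sub>\<bbbH>"
  by (simp_all add: quat_ii_def quat_jj_def quat_kk_def one_quaternion_def
      uminus_quaternion_def times_quaternion_def)

definition qnorm :: "quaternion \<Rightarrow> real" where
  "qnorm q = sqrt ((qre q)\<^sup>2 + (qi q)\<^sup>2 + (qj q)\<^sup>2 + (qk q)\<^sup>2)"

definition Sp1 :: "quaternion monoid" where
  "Sp1 = \<lparr>carrier = {q. qnorm q = 1}, monoid.mult = (*), one = 1\<rparr>"

text \<open>An element of the \<open>m\<close>-fold power is a function on \<open>{1..m}\<close>, extended by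
  \<^term>\<open>undefined\<close> outside that set.\<close>

definition Sp1_power :: "nat \<Rightarrow> (nat \<Rightarrow> quaternion) monoid" where
  "Sp1_power m = product_group {1..m} (\<lambda>_. Sp1)"

definition diag_sign :: "nat \<Rightarrow> (nat \<Rightarrow> quaternion) set" where
  "diag_sign m = generate (Sp1_power m) {\<lambda>r\<in>{1..m}. - 1}"

definition Sp1_quotient :: "nat \<Rightarrow> (nat \<Rightarrow> quaternion) set monoid" where
  "Sp1_quotient m = Sp1_power m Mod diag_sign m"

definition Sp1_proj :: "nat \<Rightarrow> (nat \<Rightarrow> quaternion) \<Rightarrow> (nat \<Rightarrow> quaternion) set" where
  "Sp1_proj m x = diag_sign m #>\<^bsub>Sp1_power m\<^esub> x"

text \<open>The tuple \<open>(a, \<dots>, a, b, c)\<close> of length \<open>m\<close>, whose first \<open>m - 2\<close> entries are \<open>a\<close>.\<close>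

definition tuple3 :: "nat \<Rightarrow> quaternion \<Rightarrow> quaternion \<Rightarrow> quaternion \<Rightarrow> nat \<Rightarrow> quaternion" where
  "tuple3 m a b c = (\<lambda>r\<in>{1..m}. if r = m then c else if r = m - 1 then b else a)"

definition Z4_squared :: "(int \<times> int) monoid" where
  "Z4_squared = integer_mod_group 4 \<times>\<times> integer_mod_group 4"

definition element_conjugate ::
    "('g, 'x) monoid_scheme \<Rightarrow> ('a, 'y) monoid_scheme \<Rightarrow> ('g \<Rightarrow> 'a) \<Rightarrow> ('g \<Rightarrow> 'a) \<Rightarrow> bool" where
  "element_conjugate \<Gamma> G \<phi>\<^sub>1 \<phi>\<^sub>2 \<longleftrightarrow>
     (\<forall>x\<in>carrier \<Gamma>. \<exists>g\<in>carrier G. \<phi>\<^sub>2 x = g \<otimes>\<^bsub>G\<^esub> \<phi>\<^sub>1 x \<otimes>\<^bsub>G\<^esub> inv\<^bsub>G\<^esub> g)"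

definition globally_conjugate ::
    "('g, 'x) monoid_scheme \<Rightarrow> ('a, 'y) monoid_scheme \<Rightarrow> ('g \<Rightarrow> 'a) \<Rightarrow> ('g \<Rightarrow> 'a) \<Rightarrow> bool" where
  "globally_conjugate \<Gamma> G \<phi>\<^sub>1 \<phi>\<^sub>2 \<longleftrightarrow>
     (\<exists>g\<in>carrier G. \<forall>x\<in>carrier \<Gamma>. \<phi>\<^sub>2 x = g \<otimes>\<^bsub>G\<^esub> \<phi>\<^sub>1 x \<otimes>\<^bsub>G\<^esub> inv\<^bsub>G\<^esub> g)"

text \<open>A definition cannot quantify over types, so the finite groups \<open>\<Gamma>\<close> range over those with
  carrier in \<^typ>\<open>nat\<close>; the lemma below transfers the property to finite groups over any type.
  The Lie group structure plays no role in the notion, since homomorphisms from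
  finite groups are automatically continuous.\<close>

definition acceptable :: "('a, 'y) monoid_scheme \<Rightarrow> bool" where
  "acceptable G \<longleftrightarrow>
     (\<forall>\<Gamma> :: nat monoid. group \<Gamma> \<and> finite (carrier \<Gamma>) \<longrightarrow>
        (\<forall>\<phi>\<^sub>1\<in>hom \<Gamma> G. \<forall>\<phi>\<^sub>2\<in>hom \<Gamma> G.
           element_conjugate \<Gamma> G \<phi>\<^sub>1 \<phi>\<^sub>2 \<longrightarrow> globally_conjugate \<Gamma> G \<phi>\<^sub>1 \<phi>\<^sub>2))"

abbreviation unacceptable :: "('a, 'y) monoid_scheme \<Rightarrow> bool" where
  "unacceptable G \<equiv> \<not> acceptable G"

lemma acceptable_finite_group:
  fixes \<Gamma> :: "('g, 'x) monoid_scheme" and G :: "('a, 'y) monoid_scheme"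
  assumes "acceptable G" and \<Gamma>: "group \<Gamma>" "finite (carrier \<Gamma>)"
    and \<phi>: "\<phi>\<^sub>1 \<in> hom \<Gamma> G" "\<phi>\<^sub>2 \<in> hom \<Gamma> G"
    and ec: "element_conjugate \<Gamma> G \<phi>\<^sub>1 \<phi>\<^sub>2"
  shows "globally_conjugate \<Gamma> G \<phi>\<^sub>1 \<phi>\<^sub>2"
proof -
  interpret group \<Gamma> by (rule \<Gamma>)
  obtain h :: "'g \<Rightarrow> nat" where h: "inj_on h (carrier \<Gamma>)"
    using \<Gamma>(2) finite_imp_inj_to_nat_seg by blast
  define k where "k = the_inv_into (carrier \<Gamma>) h"
  have kh: "k (h x) = x" if "x \<in> carrier \<Gamma>" for x
    using h that by (simp add: k_def the_inv_into_f_f)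
  define \<Delta> :: "nat monoid" where
    "\<Delta> = \<lparr>carrier = h ` carrier \<Gamma>, monoid.mult = (\<lambda>a b. h (k a \<otimes>\<^bsub>\<Gamma>\<^esub> k b)), one = h \<one>\<^bsub>\<Gamma>\<^esub>\<rparr>"
  have "group \<Delta>"
  proof (rule groupI)
    fix x assume "x \<in> carrier \<Delta>"
    then obtain a where "a \<in> carrier \<Gamma>" "x = h a" by (auto simp: \<Delta>_def)
    then show "\<exists>y\<in>carrier \<Delta>. y \<otimes>\<^bsub>\<Delta>\<^esub> x = \<one>\<^bsub>\<Delta>\<^esub>"
      by (intro bexI[of _ "h (inv\<^bsub>\<Gamma>\<^esub> a)"]) (auto simp: \<Delta>_def kh)
  qed (auto simp: \<Delta>_def kh m_assoc)
  moreover have "finite (carrier \<Delta>)"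
    using \<Gamma>(2) by (simp add: \<Delta>_def)
  moreover have "\<phi>\<^sub>1 \<circ> k \<in> hom \<Delta> G" "\<phi>\<^sub>2 \<circ> k \<in> hom \<Delta> G"
    using \<phi> by (auto simp: hom_def \<Delta>_def kh)
  moreover have "element_conjugate \<Delta> G (\<phi>\<^sub>1 \<circ> k) (\<phi>\<^sub>2 \<circ> k)"
    using ec by (auto simp: element_conjugate_def \<Delta>_def kh)
  ultimately have "globally_conjugate \<Delta> G (\<phi>\<^sub>1 \<circ> k) (\<phi>\<^sub>2 \<circ> k)"
    using assms(1) unfolding acceptable_def by blast
  then show ?thesis
    by (auto simp: globally_conjugate_def \<Delta>_def kh)
qed

lemma qnorm_mult: "qnorm (x * y) = qnorm x * qnorm y"
  unfolding qnorm_def real_sqrt_mult[symmetric]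
  by (simp add: times_quaternion_def power2_eq_square algebra_simps)

lemma group_Sp1: "group Sp1"
proof (rule groupI)
  fix x assume x: "x \<in> carrier Sp1"
  let ?y = "Quat (qre x) (- qi x) (- qj x) (- qk x)"
  have "qnorm ?y = 1" using x by (simp add: Sp1_def qnorm_def)
  moreover have "?y * x = 1"
    using x by (simp add: Sp1_def qnorm_def times_quaternion_def one_quaternion_def
        power2_eq_square algebra_simps)
  ultimately show "\<exists>y\<in>carrier Sp1. y \<otimes>\<^bsub>Sp1\<^esub> x = \<one>\<^bsub>Sp1\<^esub>"
    by (intro bexI[of _ ?y]) (auto simp: Sp1_def)
qed (auto simp: Sp1_def qnorm_mult mult.assoc, simp add: qnorm_def one_quaternion_def)

lemma group_Sp1_power: "group (Sp1_power m)"
  by (simp add: Sp1_power_def group_Sp1)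

lemma diag_sign_normal: "diag_sign m \<lhd> Sp1_power m"
proof -
  interpret group "Sp1_power m" by (rule group_Sp1_power)
  let ?c = "\<lambda>r\<in>{1..m}. - 1 :: quaternion"
  have c: "?c \<in> carrier (Sp1_power m)"
    by (auto simp: Sp1_power_def Sp1_def qnorm_def uminus_quaternion_def one_quaternion_def)
  have comm: "?c \<otimes>\<^bsub>Sp1_power m\<^esub> g = g \<otimes>\<^bsub>Sp1_power m\<^esub> ?c" for g
    by (auto simp: Sp1_power_def Sp1_def intro!: restrict_ext)
  show ?thesis
    unfolding diag_sign_def
  proof (rule normal_generateI)
    fix h g assume "h \<in> {?c}" and g: "g \<in> carrier (Sp1_power m)"
    then have "g \<otimes>\<^bsub>Sp1_power m\<^esub> h \<otimes>\<^bsub>Sp1_power m\<^esub> inv\<^bsub>Sp1_power m\<^esub> g = h"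
      using c comm[of g, symmetric] by (simp add: m_assoc)
    then show "g \<otimes>\<^bsub>Sp1_power m\<^esub> h \<otimes>\<^bsub>Sp1_power m\<^esub> inv\<^bsub>Sp1_power m\<^esub> g \<in> {?c}"
      using \<open>h \<in> {?c}\<close> by simp
  qed (use c in auto)
qed

lemma group_Sp1_quotient: "group (Sp1_quotient m)"
  unfolding Sp1_quotient_def using diag_sign_normal by (rule normal.factorgroup_is_group)

end

(*
  Both homomorphisms take gamma1^a gamma2^b to tuples of powers of i, and these tuples differ only
  in the last entry, i^(a+b) against i^a (-i)^b. For even b they agree. For odd b the last entries
  differ by a sign: if a is even, conjugation by j in the last entry produces this sign; if a is
  odd, conjugation by j in all the other entries produces it up to the central element
  (-1,...,-1). A single conjugating tuple g cannot serve all elements: the entries equal to 1 in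
  the images of gamma1 (here m >= 3 is used) and gamma2 rule out the central sign, so the last
  entry of g would have to commute with i and also conjugate i to -i.
*)
theory Submission
  imports Defs
begin

section \<open>Powers of i, conjugation by j, and norms of quaternions\<close>

lemma quat_ii_jj_anticommute: "\<i>\<^sub>\<bbbH> * \<j>\<^sub>\<bbbH> = - (\<j>\<^sub>\<bbbH> * \<i>\<^sub>\<bbbH>)"
  by (simp add: quat_ii_def quat_jj_def uminus_quaternion_def times_quaternion_def)

text \<open>Each factor i that j passes contributes one sign. So j commutes with even powers of i
  and anticommutes with odd ones, which is what the parity cases for element-conjugacy rest
  on.\<close>

lemma quat_jj_ii_power: "\<j>\<^sub>\<bbbH> * \<i>\<^sub>\<bbbH> ^ n = (- 1) ^ n * (\<i>\<^sub>\<bbbH> ^ n * \<j>\<^sub>\<bbbH>)"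
proof (induction n)
  case (Suc n)
  have "\<j>\<^sub>\<bbbH> * \<i>\<^sub>\<bbbH> ^ Suc n = (\<j>\<^sub>\<bbbH> * \<i>\<^sub>\<bbbH> ^ n) * \<i>\<^sub>\<bbbH>"
    by (simp add: power_Suc2 mult.assoc del: power_Suc)
  also have "\<dots> = (- 1) ^ n * (\<i>\<^sub>\<bbbH> ^ n * (\<j>\<^sub>\<bbbH> * \<i>\<^sub>\<bbbH>))"
    by (simp add: Suc.IH mult.assoc)
  also have "\<j>\<^sub>\<bbbH> * \<i>\<^sub>\<bbbH> = - (\<i>\<^sub>\<bbbH> * \<j>\<^sub>\<bbbH>)"
    by (simp add: quat_ii_jj_anticommute)
  also have "(- 1) ^ n * (\<i>\<^sub>\<bbbH> ^ n * - (\<i>\<^sub>\<bbbH> * \<j>\<^sub>\<bbbH>)) = (- 1) ^ Suc n * (\<i>\<^sub>\<bbbH> ^ Suc n * \<j>\<^sub>\<bbbH>)"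
    by (simp add: power_Suc2 mult.assoc del: power_Suc)
  finally show ?case .
qed simp

lemma quat_ii_power4: "\<i>\<^sub>\<bbbH> ^ 4 = 1" "(- \<i>\<^sub>\<bbbH>) ^ 4 = 1"
  by (simp_all add: eval_nat_numeral quaternion_units mult.assoc
      quaternion_units(1)[unfolded mult.assoc[symmetric]])

lemma qnorm_units:
  "qnorm 1 = 1" "qnorm \<i>\<^sub>\<bbbH> = 1" "qnorm \<j>\<^sub>\<bbbH> = 1" "qnorm (- q) = qnorm q"
  by (simp_all add: qnorm_def quat_ii_def quat_jj_def one_quaternion_def uminus_quaternion_def)

text \<open>Only 0 is its own negative, and its norm is 0. This is the source of every contradiction
  with a sign -1 in the proof that no global conjugator exists.\<close>

lemma quaternion_neq_uminus:
  assumes "qnorm q = 1" shows "q \<noteq> - q"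
  using assms by (cases q) (auto simp: qnorm_def uminus_quaternion_def)

section \<open>Coordinates in the power of Sp(1) and conjugacy in its quotient\<close>

lemma carrier_Sp1_power:
  "x \<in> carrier (Sp1_power m) \<longleftrightarrow> x \<in> extensional {1..m} \<and> (\<forall>r\<in>{1..m}. qnorm (x r) = 1)"
  by (auto simp: Sp1_power_def Sp1_def PiE_def Pi_def)

lemma mult_Sp1_power: "x \<otimes>\<^bsub>Sp1_power m\<^esub> y = (\<lambda>r\<in>{1..m}. x r * y r)"
  by (simp add: Sp1_power_def Sp1_def)

lemma one_Sp1_power: "\<one>\<^bsub>Sp1_power m\<^esub> = (\<lambda>r\<in>{1..m}. 1)"
  by (simp add: Sp1_power_def Sp1_def)

lemma pow_Sp1_power:
  fixes n :: nat
  shows "x [^]\<^bsub>Sp1_power m\<^esub> n = (\<lambda>r\<in>{1..m}. x r ^ n)"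
  by (induction n) (auto simp: one_Sp1_power mult_Sp1_power power_Suc2 simp del: power_Suc
      intro!: restrict_ext)

lemma tuple3_carrier:
  assumes "qnorm a = 1" "qnorm b = 1" "qnorm c = 1"
  shows "tuple3 m a b c \<in> carrier (Sp1_power m)"
  using assms by (simp add: carrier_Sp1_power tuple3_def)

text \<open>The generator squares to the identity and is its own inverse, so products and inverses
  produce nothing beyond these two tuples.\<close>

lemma diag_sign_eq: "diag_sign m = {\<lambda>r\<in>{1..m}. 1, \<lambda>r\<in>{1..m}. - 1}"
proof
  interpret group "Sp1_power m" by (rule group_Sp1_power)
  let ?e = "\<lambda>r\<in>{1..m}. 1 :: quaternion" and ?c = "\<lambda>r\<in>{1..m}. - 1 :: quaternion"
  have c: "?c \<in> carrier (Sp1_power m)"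
    by (simp add: carrier_Sp1_power qnorm_units)
  have cc: "?c \<otimes>\<^bsub>Sp1_power m\<^esub> ?c = ?e"
    by (auto simp: mult_Sp1_power intro!: restrict_ext)
  have inv_c: "inv\<^bsub>Sp1_power m\<^esub> ?c = ?c"
    using c cc by (intro inv_equality) (simp_all add: one_Sp1_power)
  show "diag_sign m \<subseteq> {?e, ?c}"
  proof
    fix h assume "h \<in> diag_sign m"
    then have "h \<in> generate (Sp1_power m) {?c}"
      by (simp add: diag_sign_def)
    then show "h \<in> {?e, ?c}"
    proof (induction rule: generate.induct)
      case (eng h1 h2)
      then show ?case
        using cc by (auto simp: mult_Sp1_power intro!: restrict_ext)
    qed (use inv_c in \<open>auto simp: one_Sp1_power\<close>)
  qed
  show "{?e, ?c} \<subseteq> diag_sign m"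
    unfolding diag_sign_def
    using generate.one[of "Sp1_power m" "{?c}"] by (auto simp: one_Sp1_power intro: generate.incl)
qed

text \<open>The coset of \<open>y\<close> consists of \<open>y\<close> and its negative. The sign
  \<open>s\<close> is chosen once for all coordinates; this coupling between the entries is what the
  counterexample exploits.\<close>

lemma Sp1_proj_eq_iff:
  assumes "x \<in> carrier (Sp1_power m)" "y \<in> carrier (Sp1_power m)"
  shows "Sp1_proj m x = Sp1_proj m y \<longleftrightarrow> (\<exists>s\<in>{1, - 1}. \<forall>r\<in>{1..m}. x r = s * y r)"
    (is "_ \<longleftrightarrow> ?R")
proof -
  interpret group "Sp1_power m" by (rule group_Sp1_power)
  have sub: "subgroup (diag_sign m) (Sp1_power m)"
    using diag_sign_normal by (rule normal_imp_subgroup)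
  have coset: "Sp1_proj m y = {\<lambda>r\<in>{1..m}. 1 * y r, \<lambda>r\<in>{1..m}. - 1 * y r}"
    by (auto simp: Sp1_proj_def diag_sign_eq r_coset_def mult_Sp1_power intro!: restrict_ext)
  have "Sp1_proj m x = Sp1_proj m y \<longleftrightarrow> x \<in> Sp1_proj m y"
    using repr_independence[OF _ assms(2) sub] rcos_self[OF assms(1) sub]
    by (auto simp: Sp1_proj_def)
  also have "\<dots> \<longleftrightarrow> ?R"
    using assms(1) unfolding coset carrier_Sp1_power
    by (auto simp: fun_eq_iff extensional_def)
  finally show ?thesis .
qed

lemma carrier_Sp1_quotient: "carrier (Sp1_quotient m) = Sp1_proj m ` carrier (Sp1_power m)"
  by (auto simp: Sp1_quotient_def Sp1_proj_def FactGroup_def RCOSETS_def)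

lemma Sp1_proj_hom: "Sp1_proj m \<in> hom (Sp1_power m) (Sp1_quotient m)"
  using normal.r_coset_hom_Mod[OF diag_sign_normal, of m]
  by (simp add: Sp1_proj_def[abs_def] Sp1_quotient_def)

text \<open>Multiplying by the coset of \<open>g\<close> on the right removes the inverse, and
  comparing representatives then leaves quaternion equations in each coordinate, free of inverses
  and tied together by one common sign.\<close>

lemma Sp1_proj_conjugate_iff:
  assumes "x \<in> carrier (Sp1_power m)" "y \<in> carrier (Sp1_power m)" "g \<in> carrier (Sp1_power m)"
  shows "Sp1_proj m y = Sp1_proj m g \<otimes>\<^bsub>Sp1_quotient m\<^esub> Sp1_proj m x
           \<otimes>\<^bsub>Sp1_quotient m\<^esub> inv\<^bsub>Sp1_quotient m\<^esub> Sp1_proj m g \<longleftrightarrow>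
         (\<exists>s\<in>{1, - 1}. \<forall>r\<in>{1..m}. g r * x r = s * (y r * g r))"
proof -
  interpret P: group "Sp1_power m" by (rule group_Sp1_power)
  interpret Q: group "Sp1_quotient m" by (rule group_Sp1_quotient)
  note closed = hom_in_carrier[OF Sp1_proj_hom] and mult = hom_mult[OF Sp1_proj_hom]
  have "Sp1_proj m y = Sp1_proj m g \<otimes>\<^bsub>Sp1_quotient m\<^esub> Sp1_proj m x
          \<otimes>\<^bsub>Sp1_quotient m\<^esub> inv\<^bsub>Sp1_quotient m\<^esub> Sp1_proj m g \<longleftrightarrow>
        Sp1_proj m g \<otimes>\<^bsub>Sp1_quotient m\<^esub> Sp1_proj m x =
        Sp1_proj m y \<otimes>\<^bsub>Sp1_quotient m\<^esub> Sp1_proj m g"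
    using assms closed by (intro Q.inv_solve_right) auto
  also have "\<dots> \<longleftrightarrow> Sp1_proj m (g \<otimes>\<^bsub>Sp1_power m\<^esub> x) = Sp1_proj m (y \<otimes>\<^bsub>Sp1_power m\<^esub> g)"
    using assms by (simp add: mult)
  also have "\<dots> \<longleftrightarrow> (\<exists>s\<in>{1, - 1}. \<forall>r\<in>{1..m}. g r * x r = s * (y r * g r))"
    using assms P.m_closed
    by (subst Sp1_proj_eq_iff) (auto simp: mult_Sp1_power simp flip: One_nat_def)
  finally show ?thesis .
qed

section \<open>Homomorphisms out of the square of Z/4 with arbitrary generators\<close>

lemma comm_group_Z4_squared: "comm_group Z4_squared"
  unfolding Z4_squared_def
  by (rule group.group_comm_groupI) (auto simp: DirProd_group add.commute)

lemma carrier_Z4_squared: "carrier Z4_squared = {0..<4} \<times> {0..<4}"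
  by (simp add: Z4_squared_def carrier_integer_mod_group)

lemma mult_Z4_squared:
  "(a, b) \<otimes>\<^bsub>Z4_squared\<^esub> (c, d) = ((a + c) mod 4, (b + d) mod 4)"
  by (simp add: Z4_squared_def mult_integer_mod_group)

lemma Z4_squared_exponent:
  assumes "p \<in> carrier Z4_squared"
  shows "p [^]\<^bsub>Z4_squared\<^esub> (4::nat) = \<one>\<^bsub>Z4_squared\<^esub>"
proof (cases p)
  case (Pair a b)
  have "p [^]\<^bsub>Z4_squared\<^esub> n = ((int n * a) mod 4, (int n * b) mod 4)" for n :: nat
    by (induction n) (auto simp: Pair mult_Z4_squared Z4_squared_def algebra_simps mod_simps
        one_integer_mod_group)
  then show ?thesis
    by (simp add: Z4_squared_def one_integer_mod_group)
qed

text \<open>The candidate for the homomorphism sending (1,0) to \<open>x\<close> and (0,1) to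
  \<open>y\<close>; \<open>nat\<close> turns the representatives 0,...,3 into exponents. With
  \<open>H\<close> equal to \<open>Z4_squared\<close> it becomes the change from the standard
  generators to \<open>x\<close> and \<open>y\<close>.\<close>

definition Z4_squared_lift :: "('a, 'b) monoid_scheme \<Rightarrow> 'a \<Rightarrow> 'a \<Rightarrow> int \<times> int \<Rightarrow> 'a" where
  "Z4_squared_lift H x y = (\<lambda>(a, b). x [^]\<^bsub>H\<^esub> nat a \<otimes>\<^bsub>H\<^esub> y [^]\<^bsub>H\<^esub> nat b)"

lemma (in group) pow_nat_add_mod:
  assumes "x \<in> carrier G" "x [^] (4::nat) = \<one>" "0 \<le> a" "0 \<le> b"
  shows "x [^] nat ((a + b) mod 4) = x [^] nat a \<otimes> x [^] nat b"
proof -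
  let ?n = "nat a + nat b"
  have "x [^] ?n = x [^] (4 * (?n div 4) + ?n mod 4)"
    by (simp only: mult_div_mod_eq)
  also have "\<dots> = x [^] (?n mod 4)"
    using assms(1,2) nat_pow_mult[OF assms(1), symmetric] nat_pow_pow[OF assms(1), symmetric]
    by (simp only: nat_pow_one l_one nat_pow_closed)
  also have "?n mod 4 = nat ((a + b) mod 4)"
    using assms by (simp add: nat_mod_distrib nat_add_distrib)
  finally show ?thesis
    using assms(1) by (simp add: nat_pow_mult del: pow_nat)
qed

lemma (in group) Z4_squared_lift_hom:
  assumes x: "x \<in> carrier G" "x [^] (4::nat) = \<one>" and y: "y \<in> carrier G" "y [^] (4::nat) = \<one>"
    and comm: "x \<otimes> y = y \<otimes> x"
  shows "Z4_squared_lift G x y \<in> hom Z4_squared G"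
proof (rule homI)
  fix p q assume pq: "p \<in> carrier Z4_squared" "q \<in> carrier Z4_squared"
  obtain a b where p: "p = (a, b)" by fastforce
  obtain c d where q: "q = (c, d)" by fastforce
  have nonneg: "0 \<le> a" "0 \<le> b" "0 \<le> c" "0 \<le> d"
    using pq by (auto simp: carrier_Z4_squared p q)
  have swap: "y [^] k \<otimes> x [^] l = x [^] l \<otimes> y [^] k" for k l :: nat
    using group_commutes_pow[OF group_commutes_pow[OF comm, symmetric], of l k] x y by simp
  show "Z4_squared_lift G x y (p \<otimes>\<^bsub>Z4_squared\<^esub> q) =
      Z4_squared_lift G x y p \<otimes> Z4_squared_lift G x y q"
    using x y nonneg swap[of "nat b" "nat c"]
    by (simp add: p q mult_Z4_squared Z4_squared_lift_def pow_nat_add_mod m_assoc del: pow_nat)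
      (simp flip: m_assoc del: pow_nat)
qed (use x y in \<open>auto simp: Z4_squared_lift_def\<close>)

text \<open>The image is a subgroup containing both generators, hence everything; a surjective map
  from a finite set to itself is injective.\<close>

lemma Z4_squared_lift_bij:
  assumes "\<gamma>\<^sub>1 \<in> carrier Z4_squared" "\<gamma>\<^sub>2 \<in> carrier Z4_squared"
    and gen: "generate Z4_squared {\<gamma>\<^sub>1, \<gamma>\<^sub>2} = carrier Z4_squared"
  shows "Z4_squared_lift Z4_squared \<gamma>\<^sub>1 \<gamma>\<^sub>2 \<in> iso Z4_squared Z4_squared"
proof -
  let ?e = "Z4_squared_lift Z4_squared \<gamma>\<^sub>1 \<gamma>\<^sub>2"
  interpret comm_group Z4_squared by (rule comm_group_Z4_squared)
  have hom: "?e \<in> hom Z4_squared Z4_squared"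
    using assms by (intro Z4_squared_lift_hom Z4_squared_exponent m_comm)
  then interpret e: group_hom Z4_squared Z4_squared ?e
    by unfold_locales
  have "?e (1, 0) = \<gamma>\<^sub>1" "?e (0, 1) = \<gamma>\<^sub>2"
    using assms by (simp_all add: Z4_squared_lift_def)
  moreover have "(1, 0) \<in> carrier Z4_squared" "(0, 1) \<in> carrier Z4_squared"
    by (simp_all add: carrier_Z4_squared)
  ultimately have "{\<gamma>\<^sub>1, \<gamma>\<^sub>2} \<subseteq> ?e ` carrier Z4_squared"
    by force
  then have "carrier Z4_squared \<subseteq> ?e ` carrier Z4_squared"
    using generate_subgroup_incl[OF _ e.img_is_subgroup] gen by metis
  moreover have "?e ` carrier Z4_squared \<subseteq> carrier Z4_squared"
    using hom by (auto simp: hom_def)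
  ultimately have surj: "?e ` carrier Z4_squared = carrier Z4_squared"
    by blast
  then have "inj_on ?e (carrier Z4_squared)"
    by (intro eq_card_imp_inj_on) (simp_all add: carrier_Z4_squared)
  then show ?thesis
    using hom surj by (simp add: iso_def bij_betw_def)
qed

text \<open>The inverse of the change of generators sends \<open>\<gamma>\<^sub>1\<close> and
  \<open>\<gamma>\<^sub>2\<close> to (1,0) and (0,1), and the lift into \<open>H\<close> sends these
  on to \<open>x\<close> and \<open>y\<close>. The composite is the required homomorphism.\<close>

lemma Z4_squared_hom_exists:
  assumes gen: "\<gamma>\<^sub>1 \<in> carrier Z4_squared" "\<gamma>\<^sub>2 \<in> carrier Z4_squared"
      "generate Z4_squared {\<gamma>\<^sub>1, \<gamma>\<^sub>2} = carrier Z4_squared"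
    and "group H" "x \<in> carrier H" "x [^]\<^bsub>H\<^esub> (4::nat) = \<one>\<^bsub>H\<^esub>"
      "y \<in> carrier H" "y [^]\<^bsub>H\<^esub> (4::nat) = \<one>\<^bsub>H\<^esub>" "x \<otimes>\<^bsub>H\<^esub> y = y \<otimes>\<^bsub>H\<^esub> x"
  obtains \<phi> where "\<phi> \<in> hom Z4_squared H" "\<phi> \<gamma>\<^sub>1 = x" "\<phi> \<gamma>\<^sub>2 = y"
proof
  interpret comm_group Z4_squared by (rule comm_group_Z4_squared)
  interpret H: group H by fact
  let ?e = "Z4_squared_lift Z4_squared \<gamma>\<^sub>1 \<gamma>\<^sub>2"
  let ?f = "inv_into (carrier Z4_squared) ?e"
  have e: "?e \<in> iso Z4_squared Z4_squared"
    using gen by (rule Z4_squared_lift_bij)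
  have f: "?f \<in> hom Z4_squared Z4_squared"
    using iso_set_sym[OF e] by (simp add: iso_def)
  show "Z4_squared_lift H x y \<circ> ?f \<in> hom Z4_squared H"
    by (rule Group.hom_compose[OF f]) (intro H.Z4_squared_lift_hom assms)
  have inj: "inj_on ?e (carrier Z4_squared)"
    using e by (simp add: iso_def bij_betw_def)
  have "?e (1, 0) = \<gamma>\<^sub>1" "?e (0, 1) = \<gamma>\<^sub>2"
    using gen by (simp_all add: Z4_squared_lift_def)
  then have "?f \<gamma>\<^sub>1 = (1, 0)" "?f \<gamma>\<^sub>2 = (0, 1)"
    using inv_into_f_f[OF inj, of "(1, 0)"] inv_into_f_f[OF inj, of "(0, 1)"]
    by (simp_all add: carrier_Z4_squared)
  then show "(Z4_squared_lift H x y \<circ> ?f) \<gamma>\<^sub>1 = x" "(Z4_squared_lift H x y \<circ> ?f) \<gamma>\<^sub>2 = y"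
    using assms by (simp_all add: Z4_squared_lift_def)
qed

section \<open>Existence of the two homomorphisms\<close>

text \<open>Every entry of both tuples is 1, i or -i. These commute with each other and have trivial
  fourth power, so the tuples do too. The two values of \<open>q\<close> give \<open>\<phi>\<close>
  and \<open>\<phi>'\<close>.\<close>

lemma Sp1_power_hom_exists:
  assumes "\<gamma>\<^sub>1 \<in> carrier Z4_squared" "\<gamma>\<^sub>2 \<in> carrier Z4_squared"
      "generate Z4_squared {\<gamma>\<^sub>1, \<gamma>\<^sub>2} = carrier Z4_squared"
    and "q \<in> {\<i>\<^sub>\<bbbH>, - \<i>\<^sub>\<bbbH>}"
  shows "\<exists>\<phi>\<in>hom Z4_squared (Sp1_power m).
    \<phi> \<gamma>\<^sub>1 = tuple3 m 1 \<i>\<^sub>\<bbbH> \<i>\<^sub>\<bbbH> \<and> \<phi> \<gamma>\<^sub>2 = tuple3 m \<i>\<^sub>\<bbbH> 1 q"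
proof -
  have q: "qnorm q = 1" "q ^ 4 = 1" "\<i>\<^sub>\<bbbH> * q = q * \<i>\<^sub>\<bbbH>"
    using assms(4) by (auto simp: qnorm_units quat_ii_power4)
  have carr: "tuple3 m 1 \<i>\<^sub>\<bbbH> \<i>\<^sub>\<bbbH> \<in> carrier (Sp1_power m)"
      "tuple3 m \<i>\<^sub>\<bbbH> 1 q \<in> carrier (Sp1_power m)"
    by (intro tuple3_carrier qnorm_units q)+
  show ?thesis
    by (rule Z4_squared_hom_exists[OF assms(1-3) group_Sp1_power[of m] carr(1) _ carr(2)])
      (use q in \<open>auto intro!: restrict_ext
        simp: pow_Sp1_power one_Sp1_power mult_Sp1_power tuple3_def quat_ii_power4\<close>)
qed

section \<open>Element-conjugacy\<close>

lemma element_conjugate_projections: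
  assumes gen: "\<gamma>\<^sub>1 \<in> carrier Z4_squared" "\<gamma>\<^sub>2 \<in> carrier Z4_squared"
      "generate Z4_squared {\<gamma>\<^sub>1, \<gamma>\<^sub>2} = carrier Z4_squared"
    and \<phi>: "\<phi> \<in> hom Z4_squared (Sp1_power m)"
      "\<phi> \<gamma>\<^sub>1 = tuple3 m 1 \<i>\<^sub>\<bbbH> \<i>\<^sub>\<bbbH>" "\<phi> \<gamma>\<^sub>2 = tuple3 m \<i>\<^sub>\<bbbH> 1 \<i>\<^sub>\<bbbH>"
    and \<phi>': "\<phi>' \<in> hom Z4_squared (Sp1_power m)"
      "\<phi>' \<gamma>\<^sub>1 = tuple3 m 1 \<i>\<^sub>\<bbbH> \<i>\<^sub>\<bbbH>" "\<phi>' \<gamma>\<^sub>2 = tuple3 m \<i>\<^sub>\<bbbH> 1 (- \<i>\<^sub>\<bbbH>)"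
  shows "element_conjugate Z4_squared (Sp1_quotient m) (Sp1_proj m \<circ> \<phi>) (Sp1_proj m \<circ> \<phi>')"
  unfolding element_conjugate_def
proof
  fix p assume p: "p \<in> carrier Z4_squared"
  interpret comm_group Z4_squared by (rule comm_group_Z4_squared)
  interpret P: group "Sp1_power m" by (rule group_Sp1_power)
  \<comment> \<open>Surjectivity of the change of generators writes \<open>p\<close> as a product of
    powers of \<open>\<gamma>\<^sub>1\<close> and \<open>\<gamma>\<^sub>2\<close>; only the parities
    of the exponents matter below.\<close>
  have "p \<in> Z4_squared_lift Z4_squared \<gamma>\<^sub>1 \<gamma>\<^sub>2 ` carrier Z4_squared"
    using Z4_squared_lift_bij[OF gen] p by (simp add: iso_def bij_betw_def)
  then obtain a b :: nat where ab: "p = \<gamma>\<^sub>1 [^]\<^bsub>Z4_squared\<^esub> a \<otimes>\<^bsub>Z4_squared\<^esub> \<gamma>\<^sub>2 [^]\<^bsub>Z4_squared\<^esub> b"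
    by (auto simp: Z4_squared_lift_def)
  have lift: "\<psi> p r = \<psi> \<gamma>\<^sub>1 r ^ a * \<psi> \<gamma>\<^sub>2 r ^ b"
    if \<psi>: "\<psi> \<in> hom Z4_squared (Sp1_power m)" and r: "r \<in> {1..m}" for \<psi> r
  proof -
    interpret group_hom Z4_squared "Sp1_power m" \<psi>
      using \<psi> by unfold_locales
    have "\<psi> p = \<psi> \<gamma>\<^sub>1 [^]\<^bsub>Sp1_power m\<^esub> a \<otimes>\<^bsub>Sp1_power m\<^esub> \<psi> \<gamma>\<^sub>2 [^]\<^bsub>Sp1_power m\<^esub> b"
      using gen by (simp add: ab hom_nat_pow)
    then show ?thesis
      using r by (simp add: mult_Sp1_power pow_Sp1_power)
  qed
  have closed: "\<phi> p \<in> carrier (Sp1_power m)" "\<phi>' p \<in> carrier (Sp1_power m)"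
    using p \<phi> \<phi>' by (auto intro: hom_in_carrier)
  have "\<exists>g\<in>carrier (Sp1_power m). \<exists>s\<in>{1, - 1}. \<forall>r\<in>{1..m}. g r * \<phi> p r = s * (\<phi>' p r * g r)"
  proof -
    consider "even b" | "odd b" "even a" | "odd b" "odd a" by blast
    then show ?thesis
    proof cases
      case 1
      \<comment> \<open>For even \<open>b\<close> the b-th powers of i and -i agree, so the two
        images of \<open>p\<close> coincide and the identity tuple conjugates.\<close>
      show ?thesis
        by (rule bexI[of _ "tuple3 m 1 1 1"], rule bexI[of _ 1])
          (simp_all add: lift \<phi> \<phi>' tuple3_carrier qnorm_units, use 1 in \<open>simp_all add: tuple3_def\<close>)
    next
      case 2
      \<comment> \<open>Here a + b is odd, so conjugation by j negates the last entry of the first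
        image, and this is the last entry of the second. All other entries agree already, so the
        common sign is 1.\<close>
      have "\<j>\<^sub>\<bbbH> * (\<i>\<^sub>\<bbbH> ^ a * \<i>\<^sub>\<bbbH> ^ b) = - (\<i>\<^sub>\<bbbH> ^ a * \<i>\<^sub>\<bbbH> ^ b * \<j>\<^sub>\<bbbH>)"
        using 2 quat_jj_ii_power[of "a + b"] by (simp add: power_add)
      then show ?thesis
        by (intro bexI[of _ "tuple3 m 1 1 \<j>\<^sub>\<bbbH>"] bexI[of _ 1])
          (simp_all add: lift \<phi> \<phi>' tuple3_carrier qnorm_units, use 2 in \<open>simp_all add: tuple3_def\<close>)
    next
      case 3
      \<comment> \<open>Now a + b is even and j no longer negates the last entry. The entries before
        it are the b-th or the a-th power of i, both odd, so j negates them, while the last entries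
        of the two images already differ by a sign. Hence the common sign is -1.\<close>
      then have "\<j>\<^sub>\<bbbH> * \<i>\<^sub>\<bbbH> ^ a = - (\<i>\<^sub>\<bbbH> ^ a * \<j>\<^sub>\<bbbH>)" "\<j>\<^sub>\<bbbH> * \<i>\<^sub>\<bbbH> ^ b = - (\<i>\<^sub>\<bbbH> ^ b * \<j>\<^sub>\<bbbH>)"
        using quat_jj_ii_power by simp_all
      then show ?thesis
        by (intro bexI[of _ "tuple3 m \<j>\<^sub>\<bbbH> \<j>\<^sub>\<bbbH> 1"] bexI[of _ "- 1"])
          (simp_all add: lift \<phi> \<phi>' tuple3_carrier qnorm_units, use 3 in \<open>simp_all add: tuple3_def\<close>)
    qed
  qed
  then obtain g where g: "g \<in> carrier (Sp1_power m)"
    and conj: "\<exists>s\<in>{1, - 1}. \<forall>r\<in>{1..m}. g r * \<phi> p r = s * (\<phi>' p r * g r)"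
    by blast
  show "\<exists>h\<in>carrier (Sp1_quotient m). (Sp1_proj m \<circ> \<phi>') p = h \<otimes>\<^bsub>Sp1_quotient m\<^esub>
      (Sp1_proj m \<circ> \<phi>) p \<otimes>\<^bsub>Sp1_quotient m\<^esub> inv\<^bsub>Sp1_quotient m\<^esub> h"
  proof (rule bexI)
    show "(Sp1_proj m \<circ> \<phi>') p = Sp1_proj m g \<otimes>\<^bsub>Sp1_quotient m\<^esub>
        (Sp1_proj m \<circ> \<phi>) p \<otimes>\<^bsub>Sp1_quotient m\<^esub> inv\<^bsub>Sp1_quotient m\<^esub> Sp1_proj m g"
      using Sp1_proj_conjugate_iff[OF closed g] conj by simp
  qed (use g in \<open>simp add: carrier_Sp1_quotient\<close>)
qed

section \<open>Failure of global conjugacy\<close>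

lemma not_globally_conjugate_projections:
  assumes "m \<ge> 3"
    and gen: "\<gamma>\<^sub>1 \<in> carrier Z4_squared" "\<gamma>\<^sub>2 \<in> carrier Z4_squared"
    and \<phi>: "\<phi> \<gamma>\<^sub>1 = tuple3 m 1 \<i>\<^sub>\<bbbH> \<i>\<^sub>\<bbbH>" "\<phi> \<gamma>\<^sub>2 = tuple3 m \<i>\<^sub>\<bbbH> 1 \<i>\<^sub>\<bbbH>"
    and \<phi>': "\<phi>' \<gamma>\<^sub>1 = tuple3 m 1 \<i>\<^sub>\<bbbH> \<i>\<^sub>\<bbbH>" "\<phi>' \<gamma>\<^sub>2 = tuple3 m \<i>\<^sub>\<bbbH> 1 (- \<i>\<^sub>\<bbbH>)"
  shows "\<not> globally_conjugate Z4_squared (Sp1_quotient m) (Sp1_proj m \<circ> \<phi>) (Sp1_proj m \<circ> \<phi>')"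
proof
  assume "globally_conjugate Z4_squared (Sp1_quotient m) (Sp1_proj m \<circ> \<phi>) (Sp1_proj m \<circ> \<phi>')"
  \<comment> \<open>Each element of the quotient is the coset of a tuple, so the supposed conjugator
    lifts to a tuple \<open>g\<close>.\<close>
  then obtain g where g: "g \<in> carrier (Sp1_power m)"
    and conj: "\<And>p. p \<in> carrier Z4_squared \<Longrightarrow> Sp1_proj m (\<phi>' p) = Sp1_proj m g
      \<otimes>\<^bsub>Sp1_quotient m\<^esub> Sp1_proj m (\<phi> p) \<otimes>\<^bsub>Sp1_quotient m\<^esub> inv\<^bsub>Sp1_quotient m\<^esub> Sp1_proj m g"
    by (auto simp: globally_conjugate_def carrier_Sp1_quotient)
  have norm: "qnorm (g r) = 1" if "r \<in> {1..m}" for r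
    using g that by (simp add: carrier_Sp1_power)
  have carr: "\<phi> p \<in> carrier (Sp1_power m)" "\<phi>' p \<in> carrier (Sp1_power m)" if "p \<in> {\<gamma>\<^sub>1, \<gamma>\<^sub>2}" for p
    using that by (auto simp: \<phi> \<phi>' qnorm_units intro!: tuple3_carrier)
  \<comment> \<open>The relations for the two generators hold up to signs \<open>s\<close> and
    \<open>t\<close> that are a priori independent.\<close>
  obtain s where s: "s \<in> {1, - 1}" "\<forall>r\<in>{1..m}. g r * \<phi> \<gamma>\<^sub>1 r = s * (\<phi>' \<gamma>\<^sub>1 r * g r)"
    using conj[OF gen(1)] by (subst (asm) Sp1_proj_conjugate_iff) (use carr g in blast)+
  obtain t where t: "t \<in> {1, - 1}" "\<forall>r\<in>{1..m}. g r * \<phi> \<gamma>\<^sub>2 r = t * (\<phi>' \<gamma>\<^sub>2 r * g r)"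
    using conj[OF gen(2)] by (subst (asm) Sp1_proj_conjugate_iff) (use carr g in blast)+
  \<comment> \<open>Both images of \<open>\<gamma>\<^sub>1\<close> are 1 at position 1, which for m
    >= 3 lies among the first m - 2 entries; both images of \<open>\<gamma>\<^sub>2\<close> are 1 at
    position m - 1. There the relations reduce to g = s g and g = t g.\<close>
  have "1 \<in> {1..m}" "m - 1 \<in> {1..m}"
    using \<open>m \<ge> 3\<close> by auto
  have "g 1 = s * g 1"
    using bspec[OF s(2) \<open>1 \<in> {1..m}\<close>] \<open>m \<ge> 3\<close>
    by (auto simp: \<phi> \<phi>' tuple3_def split: if_splits)
  then have "s = 1"
    using s(1) quaternion_neq_uminus[OF norm[OF \<open>1 \<in> {1..m}\<close>]] by auto
  have "g (m - 1) = t * g (m - 1)"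
    using bspec[OF t(2) \<open>m - 1 \<in> {1..m}\<close>] \<open>m \<ge> 3\<close>
    by (auto simp: \<phi> \<phi>' tuple3_def split: if_splits)
  then have "t = 1"
    using t(1) quaternion_neq_uminus[OF norm[OF \<open>m - 1 \<in> {1..m}\<close>]] by auto
  \<comment> \<open>With both signs equal to 1, the last coordinate for
    \<open>\<gamma>\<^sub>1\<close> says that \<open>g m\<close> commutes with i, and for
    \<open>\<gamma>\<^sub>2\<close> that it anticommutes with i.\<close>
  have "g m * \<i>\<^sub>\<bbbH> = \<i>\<^sub>\<bbbH> * g m" "g m * \<i>\<^sub>\<bbbH> = - (\<i>\<^sub>\<bbbH> * g m)"
    using bspec[OF s(2), of m] bspec[OF t(2), of m] \<open>s = 1\<close> \<open>t = 1\<close> \<open>m \<ge> 3\<close>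
    by (simp_all add: \<phi> \<phi>' tuple3_def)
  moreover have "qnorm (g m * \<i>\<^sub>\<bbbH>) = 1"
    using norm[of m] \<open>m \<ge> 3\<close> by (simp add: qnorm_mult qnorm_units)
  ultimately show False
    using quaternion_neq_uminus by metis
qed

theorem mainTheorem4:
  fixes m :: nat and \<gamma>\<^sub>1 \<gamma>\<^sub>2 :: "int \<times> int"
  assumes "m \<ge> 3"
    and "\<gamma>\<^sub>1 \<in> carrier Z4_squared" and "\<gamma>\<^sub>2 \<in> carrier Z4_squared"
    and "generate Z4_squared {\<gamma>\<^sub>1, \<gamma>\<^sub>2} = carrier Z4_squared"
  shows
    "(\<exists>\<phi>\<in>hom Z4_squared (Sp1_power m). \<exists>\<phi>'\<in>hom Z4_squared (Sp1_power m).
        \<phi> \<gamma>\<^sub>1 = tuple3 m 1 \<i>\<^sub>\<bbbH> \<i>\<^sub>\<bbbH> \<and> \<phi>' \<gamma>\<^sub>1 = tuple3 m 1 \<i>\<^sub>\<bbbH> \<i>\<^sub>\<bbbH> \<and>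
        \<phi> \<gamma>\<^sub>2 = tuple3 m \<i>\<^sub>\<bbbH> 1 \<i>\<^sub>\<bbbH> \<and> \<phi>' \<gamma>\<^sub>2 = tuple3 m \<i>\<^sub>\<bbbH> 1 (- \<i>\<^sub>\<bbbH>)) \<and>
     (\<forall>\<phi>\<in>hom Z4_squared (Sp1_power m). \<forall>\<phi>'\<in>hom Z4_squared (Sp1_power m).
        \<phi> \<gamma>\<^sub>1 = tuple3 m 1 \<i>\<^sub>\<bbbH> \<i>\<^sub>\<bbbH> \<and> \<phi>' \<gamma>\<^sub>1 = tuple3 m 1 \<i>\<^sub>\<bbbH> \<i>\<^sub>\<bbbH> \<and>
        \<phi> \<gamma>\<^sub>2 = tuple3 m \<i>\<^sub>\<bbbH> 1 \<i>\<^sub>\<bbbH> \<and> \<phi>' \<gamma>\<^sub>2 = tuple3 m \<i>\<^sub>\<bbbH> 1 (- \<i>\<^sub>\<bbbH>) \<longrightarrow>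
        (let \<rho> = Sp1_proj m \<circ> \<phi>; \<rho>' = Sp1_proj m \<circ> \<phi>' in
           element_conjugate Z4_squared (Sp1_quotient m) \<rho> \<rho>' \<and>
           \<not> globally_conjugate Z4_squared (Sp1_quotient m) \<rho> \<rho>')) \<and>
     unacceptable (Sp1_quotient m)"
proof -
  note gen = assms(2-4)
  \<comment> \<open>This pair settles the existence claim and also supplies the counterexample to
    acceptability.\<close>
  obtain \<phi>\<^sub>1 \<phi>\<^sub>2 where ex: "\<phi>\<^sub>1 \<in> hom Z4_squared (Sp1_power m)" "\<phi>\<^sub>2 \<in> hom Z4_squared (Sp1_power m)"
      "\<phi>\<^sub>1 \<gamma>\<^sub>1 = tuple3 m 1 \<i>\<^sub>\<bbbH> \<i>\<^sub>\<bbbH>" "\<phi>\<^sub>1 \<gamma>\<^sub>2 = tuple3 m \<i>\<^sub>\<bbbH> 1 \<i>\<^sub>\<bbbH>"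
      "\<phi>\<^sub>2 \<gamma>\<^sub>1 = tuple3 m 1 \<i>\<^sub>\<bbbH> \<i>\<^sub>\<bbbH>" "\<phi>\<^sub>2 \<gamma>\<^sub>2 = tuple3 m \<i>\<^sub>\<bbbH> 1 (- \<i>\<^sub>\<bbbH>)"
    using Sp1_power_hom_exists[OF gen, of "\<i>\<^sub>\<bbbH>" m] Sp1_power_hom_exists[OF gen, of "- \<i>\<^sub>\<bbbH>" m] by auto
  have "unacceptable (Sp1_quotient m)"
  proof
    assume "acceptable (Sp1_quotient m)"
    moreover have "group Z4_squared" "finite (carrier Z4_squared)"
      using comm_group_Z4_squared by (simp_all add: comm_group_def carrier_Z4_squared)
    \<comment> \<open>The definition of \<open>acceptable\<close> ranges over groups on natural
      numbers, while \<open>Z4_squared\<close> lives on pairs of integers;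
      \<open>acceptable_finite_group\<close> carries the property over.\<close>
    ultimately have "globally_conjugate Z4_squared (Sp1_quotient m)
        (Sp1_proj m \<circ> \<phi>\<^sub>1) (Sp1_proj m \<circ> \<phi>\<^sub>2)"
      using ex hom_compose[OF _ Sp1_proj_hom] element_conjugate_projections[OF gen]
      by (intro acceptable_finite_group) auto
    then show False
      using not_globally_conjugate_projections[OF assms(1) gen(1,2)] ex by blast
  qed
  moreover have "element_conjugate Z4_squared (Sp1_quotient m) (Sp1_proj m \<circ> \<phi>) (Sp1_proj m \<circ> \<phi>') \<and>
      \<not> globally_conjugate Z4_squared (Sp1_quotient m) (Sp1_proj m \<circ> \<phi>) (Sp1_proj m \<circ> \<phi>')"
    if "\<phi> \<in> hom Z4_squared (Sp1_power m)" "\<phi>' \<in> hom Z4_squared (Sp1_power m)"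
      "\<phi> \<gamma>\<^sub>1 = tuple3 m 1 \<i>\<^sub>\<bbbH> \<i>\<^sub>\<bbbH>" "\<phi>' \<gamma>\<^sub>1 = tuple3 m 1 \<i>\<^sub>\<bbbH> \<i>\<^sub>\<bbbH>"
      "\<phi> \<gamma>\<^sub>2 = tuple3 m \<i>\<^sub>\<bbbH> 1 \<i>\<^sub>\<bbbH>" "\<phi>' \<gamma>\<^sub>2 = tuple3 m \<i>\<^sub>\<bbbH> 1 (- \<i>\<^sub>\<bbbH>)" for \<phi> \<phi>'
    using that element_conjugate_projections[OF gen]
      not_globally_conjugate_projections[OF assms(1) gen(1,2)] by blast
  ultimately show ?thesis
    unfolding Let_def using ex by blast
qed

end
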